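(* Let $n\in\mathbb{N}$ and let $S\subset B_n$ be a nondegenerate $n$-dimensional simplex with vertices $x^{(1)},\dots,x^{(n+1)}\in B_n$ and node matrix $\mathbf{A}$. Let $P: C(B_n)\to\Pi_1(\mathbb{R}^n)$ be the interpolation projector corresponding to $S$. Then $$\|P\|_{B_n}\ \ge\ \chi_n^{-1}\!\left(\frac{\varkappa_n}{\operatorname{vol}(S)}\right)=\chi_n^{-1}\!\left(\frac{n!\,\varkappa_n}{|\det(\mathbf{A})|}\right).$$
   Context: $\|x\|=(\sum_{i=1}^n x_i^2)^{1/2}$ and $B_n=\{x\in\mathbb{R}^n:\|x\|\le 1\}$. $C(B_n)$ is the space of continuous $f:B_n\to\mathbb{R}$ with norm $\|f\|_{C(B_n)}=\max_{x\in B_n}|f(x)|$. $\Pi_1(\mathbb{R}^n)$ is the set of polynomials in $n$ variables of degree at most $1$. For a nondegenerate simplex $S$ with vertices $x^{(j)}=(x^{(j)}_1,\dots,x^{(j)}_n)$, $1\le j\le n+1$, the node matrix $\mathbf{A}$ is the $(n+1)\times(n+1)$ matrix whose $j$-th row is $(x^{(j)}_1,\dots,x^{(j)}_n,1)$; $\operatorname{vol}(S)=|\det\mathbf{A}|/n!$. The interpolation projector $P$ corresponding to $S$ is the map sending $f\in C(B_n)$ to the unique $Pf\in\Pi_1(\mathbb{R}^n)$ with $Pf(x^{(j)})=f(x^{(j)})$ for all $j$; $\|P\|_{B_n}$ denotes its operator norm from $C(B_n)$ to $C(B_n)$ (equivalently $\max_{x\in B_n}\sum_{j}|\lambda_j(x)|$,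 where $\lambda_j(x)$ are the barycentric coordinates of $x$ with respect to $S$). $\chi_n(t)=\frac{1}{2^n n!}\frac{d^n}{dt^n}[(t^2-1)^n]$ is the Legendre polynomial of degree $n$; it satisfies $\chi_n(1)=1$ and is strictly increasing on $[1,+\infty)$, and $\chi_n^{-1}$ denotes the inverse of $\chi_n$ restricted to $[1,+\infty)$. $\varkappa_n=\operatorname{vol}(B_n)$. *)

theory Defs
  imports "HOL-Analysis.Analysis"
begin

definition unit_ball :: "(real^'n) set" where
  "unit_ball = cball 0 1"

definition Pi1 :: "((real^'n) \<Rightarrow> real) set" where
  "Pi1 = {p. \<exists>a b. \<forall>x. p x = a \<bullet> x + b}"

text \<open>Node matrix: vertices indexed by 'n option (n+1 vertices); row j is
  (x^(j)_1, ..., x^(j)_n, 1), the column None holds the constant 1.\<close>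
definition node_matrix :: "('n option \<Rightarrow> real^'n) \<Rightarrow> real^('n option)^('n option)" where
  "node_matrix V = (\<chi> j k. case k of Some i \<Rightarrow> V j $ i | None \<Rightarrow> 1)"

definition simplex_vol :: "('n::finite option \<Rightarrow> real^'n) \<Rightarrow> real" where
  "simplex_vol V = \<bar>det (node_matrix V)\<bar> / fact CARD('n)"

definition interp :: "('n option \<Rightarrow> real^'n) \<Rightarrow> ((real^'n) \<Rightarrow> real) \<Rightarrow> ((real^'n) \<Rightarrow> real)" where
  "interp V f = (THE p. p \<in> Pi1 \<and> (\<forall>j. p (V j) = f (V j)))"

definition interp_norm :: "('n::finite option \<Rightarrow> real^'n) \<Rightarrow> real" where
  "interp_norm V = (SUP f \<in> {f. continuous_on unit_ball f \<and> (\<forall>x\<in>unit_ball. \<bar>f x\<bar> \<le> 1)}.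
                      (SUP x \<in> unit_ball. \<bar>interp V f x\<bar>))"

text \<open>Legendre polynomial (Rodrigues formula) and its inverse on [1,\<infinity>).\<close>
definition legendre :: "nat \<Rightarrow> real \<Rightarrow> real" where
  "legendre n t = ((deriv ^^ n) (\<lambda>s. (s^2 - 1)^n) t) / (2^n * fact n)"

definition legendre_inv :: "nat \<Rightarrow> real \<Rightarrow> real" where
  "legendre_inv n y = (THE t. t \<ge> 1 \<and> legendre n t = y)"

definition kappa :: "'n::finite itself \<Rightarrow> real" where
  "kappa _ = measure lborel (unit_ball :: (real^'n) set)"

end

theory Submission
  imports Defs
begin

text \<open>
  Let \<open>t\<close> be the norm of the projector. Testing with continuous functions that take the values
  \<open>sgn (\<lambda>\<^sub>j x)\<close> at the vertices shows \<open>(\<Sum>j. \<bar>\<lambda>\<^sub>j x\<bar>) \<le> t\<close> for all \<open>x\<close> in the ball. As the barycentric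
  coordinates \<open>\<lambda>\<^sub>j x\<close> add up to 1, their positive parts then sum to at most \<open>a = (t + 1) / 2\<close> and their
  negative parts to at most \<open>b = (t - 1) / 2\<close>. Hence the ball lies in an affine image of the set
  \<open>E\<close> of all \<open>u\<close> in \<open>n\<close>-space whose positive and negative parts have sums at most \<open>a\<close> and \<open>b\<close>.
  Sorting by the number \<open>k\<close> of negative coordinates, \<open>E\<close> has volume
  \<open>\<Sum>k\<le>n. (n choose k) * a^(n-k) / (n-k)! * b^k / k!\<close>, and by Leibniz' rule applied to
  \<open>(t - 1)^n * (t + 1)^n\<close> this is \<open>\<chi>\<^sub>n(t) / n!\<close>; so \<open>\<kappa>\<^sub>n \<le> vol S * \<chi>\<^sub>n(t)\<close>. The case \<open>t = 1\<close>, where the affine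
  image of \<open>E\<close> is \<open>S\<close> itself, gives \<open>vol S \<le> \<kappa>\<^sub>n\<close>, so that \<open>\<chi>\<^sub>n\<close> does take the value
  \<open>\<kappa>\<^sub>n / vol S\<close> on \<open>[1, \<infinity>)\<close>.
\<close>

subsection \<open>Legendre polynomials\<close>

text \<open>Pascal's rule for sums over index pairs of total \<open>m\<close>: each pair has either
  its first or its second index raised by one. Leibniz' rule and the volume recursion both take this
  form.\<close>

lemma pascal_sum:
  fixes h :: "nat \<Rightarrow> nat \<Rightarrow> real"
  shows "(\<Sum>k\<le>Suc m. real (Suc m choose k) * h (Suc m - k) k) =
    (\<Sum>k\<le>m. real (m choose k) * h (Suc (m - k)) k) + (\<Sum>k\<le>m. real (m choose k) * h (m - k) (Suc k))"
proof -
  have "(\<Sum>k\<le>m. real (m choose k) * h (Suc (m - k)) k) = (\<Sum>k\<le>Suc m. real (m choose k) * h (Suc m - k) k)"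
    by (simp add: Suc_diff_le)
  also have "\<dots> = h (Suc m) 0 + (\<Sum>k\<le>m. real (m choose Suc k) * h (m - k) (Suc k))"
    by (subst sum.atMost_Suc_shift) simp
  finally show ?thesis
    by (subst sum.atMost_Suc_shift) (simp add: distrib_right sum.distrib)
qed

text \<open>Leibniz' rule for families in which \<open>f k\<close> and \<open>g k\<close> are the
  k-th derivatives of \<open>f 0\<close> and \<open>g 0\<close>.\<close>

lemma higher_deriv_mult_real:
  fixes f g :: "nat \<Rightarrow> real \<Rightarrow> real"
  assumes f: "\<And>k s. (f k has_real_derivative f (Suc k) s) (at s)"
    and g: "\<And>k s. (g k has_real_derivative g (Suc k) s) (at s)"
  shows "(deriv ^^ m) (\<lambda>s. f 0 s * g 0 s) = (\<lambda>s. \<Sum>k\<le>m. real (m choose k) * (f (m - k) s * g k s))"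
proof (induction m)
  case (Suc m)
  have "((\<lambda>s. \<Sum>k\<le>m. real (m choose k) * (f (m - k) s * g k s)) has_real_derivative
      (\<Sum>k\<le>Suc m. real (Suc m choose k) * (f (Suc m - k) s * g k s))) (at s)" for s
    unfolding pascal_sum [of m "\<lambda>i j. f i s * g j s"] sum.distrib [symmetric]
    by (intro DERIV_sum) (auto intro!: derivative_eq_intros f g simp: algebra_simps)
  then show ?case
    by (simp only: funpow.simps o_def Suc.IH) (rule ext, rule DERIV_imp_deriv)
qed simp

text \<open>The volume of \<open>split_simplex a b\<close> in dimension \<open>m\<close>: choose the
  \<open>k\<close> negative coordinates, then multiply the volumes of corner simplices of sizes
  \<open>a\<close> and \<open>b\<close>.\<close>

definition split_vol :: "nat \<Rightarrow> real \<Rightarrow> real \<Rightarrow> real" where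
  "split_vol m a b = (\<Sum>k\<le>m. real (m choose k) * (a ^ (m - k) / fact (m - k) * (b ^ k / fact k)))"

lemma legendre_eq_split_vol: "legendre n t = fact n * split_vol n ((t + 1) / 2) ((t - 1) / 2)"
proof -
  \<comment> \<open>\<open>p u k\<close> is the k-th derivative of \<open>(s + u) ^ n\<close>.
    Truncated subtraction makes \<open>c k\<close> vanish for k > n, so the derivative rule holds
    for every \<open>k\<close>.\<close>
  define c where "c k = (\<Prod>i<k. real (n - i))" for k
  define p where "p u k s = c k * (s + u) ^ (n - k)" for u k and s :: real
  have c: "c k = fact n / fact (n - k)" if "k \<le> n" for k
    using that by (induction k) (auto simp: c_def Suc_diff_Suc [symmetric] field_simps)
  have p: "(p u k has_real_derivative p u (Suc k) s) (at s)" for u k s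
    unfolding p_def c_def by (auto intro!: derivative_eq_intros simp: algebra_simps)
  have "(\<lambda>s. (s\<^sup>2 - 1) ^ n) = (\<lambda>s. p (-1) 0 s * p 1 0 s)"
    by (simp add: p_def c_def power_mult_distrib [symmetric] algebra_simps power2_eq_square)
  then have "(deriv ^^ n) (\<lambda>s. (s\<^sup>2 - 1) ^ n) t = (\<Sum>k\<le>n. real (n choose k) * (p (-1) (n - k) t * p 1 k t))"
    by (simp only: higher_deriv_mult_real [of "p (-1)" "p 1", OF p p])
  also have "\<dots> = (\<Sum>k\<le>n. 2 ^ n * fact n * (fact n *
      (real (n choose k) * (((t + 1) / 2) ^ (n - k) / fact (n - k) * (((t - 1) / 2) ^ k / fact k)))))"
  proof (rule sum.cong)
    fix k assume "k \<in> {..n}"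
    moreover from this have "(2::real) ^ n = 2 ^ (n - k) * 2 ^ k"
      by (simp add: power_add [symmetric])
    ultimately show "real (n choose k) * (p (-1) (n - k) t * p 1 k t) = 2 ^ n * fact n * (fact n *
      (real (n choose k) * (((t + 1) / 2) ^ (n - k) / fact (n - k) * (((t - 1) / 2) ^ k / fact k))))"
      by (simp add: p_def c field_simps)
  qed simp
  finally show ?thesis
    by (simp only: legendre_def split_vol_def sum_distrib_left [symmetric]) simp
qed

text \<open>For t >= 1 both (t + 1) / 2 and (t - 1) / 2 are nonnegative, so every term of
  \<open>split_vol\<close> is monotone in t; the term k = 0 is strictly so.\<close>

lemma strict_mono_on_legendre:
  assumes "n > 0"
  shows "strict_mono_on {1..} (legendre n)"
proof (rule strict_mono_onI)
  fix s t :: real assume st: "s \<in> {1..}" "t \<in> {1..}" "s < t"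
  have "split_vol n ((s + 1) / 2) ((s - 1) / 2) < split_vol n ((t + 1) / 2) ((t - 1) / 2)"
    unfolding split_vol_def
  proof (rule sum_strict_mono_ex1)
    show "\<forall>k\<in>{..n}. real (n choose k) * (((s + 1) / 2) ^ (n - k) / fact (n - k) * (((s - 1) / 2) ^ k / fact k))
      \<le> real (n choose k) * (((t + 1) / 2) ^ (n - k) / fact (n - k) * (((t - 1) / 2) ^ k / fact k))"
      using st by (intro ballI mult_left_mono mult_mono divide_right_mono power_mono) auto
    have "((s + 1) / 2) ^ n < ((t + 1) / 2) ^ n"
      using st assms by (intro power_strict_mono) auto
    then show "\<exists>k\<in>{..n}. real (n choose k) * (((s + 1) / 2) ^ (n - k) / fact (n - k) * (((s - 1) / 2) ^ k / fact k))
      < real (n choose k) * (((t + 1) / 2) ^ (n - k) / fact (n - k) * (((t - 1) / 2) ^ k / fact k))"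
      by (intro bexI [of _ 0]) (auto simp: divide_strict_right_mono)
  qed simp
  then show "legendre n s < legendre n t"
    by (simp add: legendre_eq_split_vol)
qed

lemma split_vol_0_right: "split_vol n a 0 = a ^ n / fact n"
proof -
  have "split_vol n a 0 = (\<Sum>k\<in>{0}. real (n choose k) * (a ^ (n - k) / fact (n - k) * (0 ^ k / fact k)))"
    unfolding split_vol_def by (rule sum.mono_neutral_right) (auto simp: power_0_left)
  then show ?thesis by simp
qed

text \<open>The definite description must be shown to denote: the intermediate value theorem on
  [1, t] supplies a preimage, and strict monotonicity makes it unique.\<close>

lemma legendre_inv_le:
  assumes "n > 0" "1 \<le> t" "1 \<le> y" "y \<le> legendre n t"
  shows "legendre_inv n y \<le> t"
proof -
  have "legendre n 1 = 1"
    by (simp add: legendre_eq_split_vol split_vol_0_right)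
  moreover have "continuous_on {1..t} (legendre n)"
    unfolding legendre_eq_split_vol split_vol_def by (intro continuous_intros) auto
  ultimately obtain s where s: "1 \<le> s" "s \<le> t" "legendre n s = y"
    using IVT' [of "legendre n" 1 y t] assms by auto
  have "inj_on (legendre n) {1..}"
    using strict_mono_on_legendre [OF \<open>n > 0\<close>] by (rule strict_mono_on_imp_inj_on)
  then have "legendre_inv n y = s"
    unfolding legendre_inv_def using s by (intro the_equality) (auto dest: inj_onD)
  then show ?thesis using s by simp
qed

subsection \<open>Vectors with bounded positive and negative part\<close>

text \<open>Induction on the coordinates with Fubini: a new coordinate y >= 0 leaves the bounds a -
  y and b for the others, a negative one leaves a and b + y. Integrating over y gives the two sums
  of \<open>pascal_sum\<close>.\<close>

lemma emeasure_split_simplex_aux: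
  assumes "finite (A :: 'a set)" "a \<ge> 0" "b \<ge> 0"
  shows "emeasure (Pi\<^sub>M A (\<lambda>_. lborel))
      ({x. (\<Sum>i\<in>A. max (x i) 0) \<le> a \<and> (\<Sum>i\<in>A. max (- x i) 0) \<le> b} \<inter> space (Pi\<^sub>M A (\<lambda>_. lborel)))
    = ennreal (split_vol (card A) a b)"
  using assms
proof (induction arbitrary: a b rule: finite_induct)
  case empty
  then show ?case by (simp add: PiM_empty split_vol_def)
next
  case (insert j A)
  let ?M = "\<lambda>A. Pi\<^sub>M A (\<lambda>_. lborel :: real measure)"
  let ?E = "\<lambda>A a b. {x. (\<Sum>i\<in>A. max (x i) 0) \<le> a \<and> (\<Sum>i\<in>A. max (- x i) 0) \<le> b} \<inter> space (?M A)"
  define m where "m = card A"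
  note [simp] = insert.hyps
  interpret product_sigma_finite "\<lambda>_. lborel"
    by standard
  have meas [measurable]: "?E B a b \<in> sets (?M B)" if "finite B" for a b and B :: "'a set"
  proof -
    have "?E B a b = {x \<in> space (?M B). (\<Sum>i\<in>B. max (x i) 0) \<le> a \<and> (\<Sum>i\<in>B. max (- x i) 0) \<le> b}"
      by auto
    then show ?thesis using that by simp
  qed
  have nonneg: "0 \<le> (\<Sum>i\<in>A. max (x i) 0)" "0 \<le> (\<Sum>i\<in>A. max (- x i) 0)" for x :: "'a \<Rightarrow> real"
    by (auto intro: sum_nonneg)
  have upd: "(\<Sum>i\<in>A. max (if i = j then y else x i) 0) = (\<Sum>i\<in>A. max (x i) 0)"
    "(\<Sum>i\<in>A. max (- (if i = j then y else x i)) 0) = (\<Sum>i\<in>A. max (- x i) 0)" for x and y :: real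
    by (auto intro!: sum.cong)
  \<comment> \<open>Outside [-b, a] the slice is empty, because the remaining sums are
    nonnegative.\<close>
  have ind: "indicator (?E (insert j A) a b) (x(j := y)) =
      (indicator {0..a} y * indicator (?E A (a - y) b) x +
       indicator {-b..<0} y * indicator (?E A a (b + y)) x :: ennreal)"
    if "x \<in> space (?M A)" for x y
  proof -
    have "x(j := y) \<in> space (?M (insert j A))"
      using that by (auto simp: space_PiM PiE_def extensional_def)
    then show ?thesis
      using that nonneg [of x] by (cases "0 \<le> y") (auto simp: indicator_def upd)
  qed
  have "emeasure (?M (insert j A)) (?E (insert j A) a b) =
      (\<integral>\<^sup>+ x. indicator (?E (insert j A) a b) x \<partial>?M (insert j A))"
    by (subst nn_integral_indicator) auto
  also have "\<dots> = (\<integral>\<^sup>+ y. \<integral>\<^sup>+ x. indicator (?E (insert j A) a b) (x(j := y)) \<partial>?M A \<partial>lborel)"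
    by (intro product_nn_integral_insert_rev) auto
  also have "\<dots> = (\<integral>\<^sup>+ y. (\<integral>\<^sup>+ x. indicator {0..a} y * indicator (?E A (a - y) b) x +
       indicator {-b..<0} y * indicator (?E A a (b + y)) x \<partial>?M A) \<partial>lborel)"
    by (intro nn_integral_cong ind)
  also have "\<dots> = (\<integral>\<^sup>+ y. indicator {0..a} y * emeasure (?M A) (?E A (a - y) b) +
       indicator {-b..<0} y * emeasure (?M A) (?E A a (b + y)) \<partial>lborel)"
    by (subst nn_integral_add) (auto simp: nn_integral_cmult)
  also have "\<dots> = (\<integral>\<^sup>+ y. ennreal (split_vol m (a - y) b) * indicator {0..a} y +
       ennreal (split_vol m a (b + y)) * indicator {-b..0} y \<partial>lborel)"
  proof (intro nn_integral_cong_AE)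
    \<comment> \<open>Ignoring the null point 0 allows the half-open interval to be closed, as
      \<open>nn_integral_FTC_Icc\<close> requires.\<close>
    have "AE y in lborel. y \<noteq> (0::real)"
      by (rule AE_lborel_singleton)
    then show "AE y in lborel. indicator {0..a} y * emeasure (?M A) (?E A (a - y) b) +
       indicator {-b..<0} y * emeasure (?M A) (?E A a (b + y)) = ennreal (split_vol m (a - y) b) * indicator {0..a} y +
       ennreal (split_vol m a (b + y)) * indicator {-b..0} y"
    proof eventually_elim
      case (elim y)
      then show ?case
        using insert.IH [of "a - y" b] insert.IH [of a "b + y"] insert.prems
        by (auto simp: indicator_def m_def)
    qed
  qed
  also have "\<dots> = (\<integral>\<^sup>+ y. ennreal (split_vol m (a - y) b) * indicator {0..a} y \<partial>lborel) +
       (\<integral>\<^sup>+ y. ennreal (split_vol m a (b + y)) * indicator {-b..0} y \<partial>lborel)"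
    unfolding split_vol_def by (intro nn_integral_add) auto
  also have "(\<integral>\<^sup>+ y. ennreal (split_vol m (a - y) b) * indicator {0..a} y \<partial>lborel) =
      ennreal (\<Sum>k\<le>m. real (m choose k) * (a ^ Suc (m - k) / fact (Suc (m - k)) * (b ^ k / fact k)))"
    (is "_ = ennreal ?I1")
  proof -
    \<comment> \<open>An antiderivative in y that vanishes at y = a.\<close>
    let ?F = "\<lambda>y. - (\<Sum>k\<le>m. real (m choose k) * ((a - y) ^ Suc (m - k) / fact (Suc (m - k)) * (b ^ k / fact k)))"
    have "(\<integral>\<^sup>+ y. ennreal (split_vol m (a - y) b) * indicator {0..a} y \<partial>lborel) = ennreal (?F a - ?F 0)"
    proof (rule nn_integral_FTC_Icc)
      show "(?F has_real_derivative split_vol m (a - y) b) (at y)" for y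
        unfolding split_vol_def sum_negf [symmetric]
        by (intro DERIV_sum) (auto intro!: derivative_eq_intros simp: divide_simps simp del: power_Suc)
      show "0 \<le> split_vol m (a - y) b" if "y \<in> {0..a}" for y
        using that insert.prems unfolding split_vol_def by (intro sum_nonneg) auto
    qed (use insert.prems in \<open>auto simp: split_vol_def\<close>)
    then show ?thesis by (simp)
  qed
  also have "(\<integral>\<^sup>+ y. ennreal (split_vol m a (b + y)) * indicator {-b..0} y \<partial>lborel) =
      ennreal (\<Sum>k\<le>m. real (m choose k) * (a ^ (m - k) / fact (m - k) * (b ^ Suc k / fact (Suc k))))"
    (is "_ = ennreal ?I2")
  proof -
    let ?F = "\<lambda>y. \<Sum>k\<le>m. real (m choose k) * (a ^ (m - k) / fact (m - k) * ((b + y) ^ Suc k / fact (Suc k)))"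
    have "(\<integral>\<^sup>+ y. ennreal (split_vol m a (b + y)) * indicator {-b..0} y \<partial>lborel) = ennreal (?F 0 - ?F (-b))"
    proof (rule nn_integral_FTC_Icc)
      show "(?F has_real_derivative split_vol m a (b + y)) (at y)" for y
        unfolding split_vol_def
        by (intro DERIV_sum) (auto intro!: derivative_eq_intros simp: divide_simps simp del: power_Suc)
      show "0 \<le> split_vol m a (b + y)" if "y \<in> {-b..0}" for y
        using that insert.prems unfolding split_vol_def by (intro sum_nonneg) auto
    qed (use insert.prems in \<open>auto simp: split_vol_def\<close>)
    then show ?thesis by simp
  qed
  also have "ennreal ?I1 + ennreal ?I2 = ennreal (?I1 + ?I2)"
    using insert.prems by (intro ennreal_plus [symmetric] sum_nonneg) auto
  also have "?I1 + ?I2 = split_vol (card (insert j A)) a b"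
    unfolding split_vol_def
    using pascal_sum [of m "\<lambda>i k. a ^ i / fact i * (b ^ k / fact k)"] by (simp add: m_def)
  finally show ?case .
qed

definition split_simplex :: "real \<Rightarrow> real \<Rightarrow> (real^'n) set" where
  "split_simplex a b = {x. (\<Sum>i\<in>UNIV. max (x $ i) 0) \<le> a \<and> (\<Sum>i\<in>UNIV. max (- (x $ i)) 0) \<le> b}"

lemma emeasure_split_simplex:
  assumes "a \<ge> 0" "b \<ge> 0"
  shows "emeasure lborel (split_simplex a b :: (real^'n) set) = ennreal (split_vol CARD('n) a b)"
proof -
  have sum_Basis: "(\<Sum>i\<in>Basis. f (x \<bullet> i)) = (\<Sum>i\<in>UNIV. f (x $ i))" for f :: "real \<Rightarrow> real" and x :: "real^'n"
  proof -
    have "Basis = range (\<lambda>i. axis i 1 :: real^'n)"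
      by (auto simp: Basis_vec_def)
    then have "(\<Sum>i\<in>Basis. f (x \<bullet> i)) = (\<Sum>i\<in>range (\<lambda>i. axis i 1). f (x \<bullet> i))"
      by (rule arg_cong)
    also have "\<dots> = (\<Sum>i\<in>UNIV. f (x $ i))"
      by (subst sum.reindex) (auto simp: inj_def axis_eq_axis inner_axis)
    finally show ?thesis .
  qed
  have eq: "split_simplex a b = {x::real^'n. (\<Sum>i\<in>Basis. max (x \<bullet> i) 0) \<le> a \<and> (\<Sum>i\<in>Basis. max (- (x \<bullet> i)) 0) \<le> b}"
    using sum_Basis [of "\<lambda>u. max u 0"] sum_Basis [of "\<lambda>u. max (- u) 0"] by (simp add: split_simplex_def)
  have "emeasure lborel (split_simplex a b :: (real^'n) set) =
      emeasure (distr (Pi\<^sub>M Basis (\<lambda>b. lborel)) borel (\<lambda>f. \<Sum>b\<in>Basis. f b *\<^sub>R b)) (split_simplex a b :: (real^'n) set)"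
    by (subst lborel_eq) simp
  also have "\<dots> = emeasure (Pi\<^sub>M Basis (\<lambda>_. lborel))
      ({x :: real^'n \<Rightarrow> real. (\<Sum>i\<in>Basis. max (x i) 0) \<le> a \<and> (\<Sum>i\<in>Basis. max (- x i) 0) \<le> b}
        \<inter> space (Pi\<^sub>M Basis (\<lambda>_. lborel)))"
    unfolding eq by (subst emeasure_distr) auto
  also have "\<dots> = ennreal (split_vol CARD('n) a b)"
    using assms by (subst emeasure_split_simplex_aux) auto
  finally show ?thesis .
qed

lemma split_simplex_lmeasurable:
  assumes "a \<ge> 0" "b \<ge> 0"
  shows "split_simplex a b \<in> (lmeasurable :: (real^'n) set set)"
    and "measure lebesgue (split_simplex a b :: (real^'n) set) = split_vol CARD('n) a b"
proof -
  let ?E = "split_simplex a b :: (real^'n) set"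
  have "closed ?E"
    unfolding split_simplex_def by (intro closed_Collect_conj closed_Collect_le continuous_intros)
  then have sets: "?E \<in> sets lborel" by simp
  have em: "emeasure lborel ?E = ennreal (split_vol CARD('n) a b)"
    by (rule emeasure_split_simplex [OF assms])
  show "?E \<in> lmeasurable"
    using sets em by (intro fmeasurableI) auto
  have "split_vol CARD('n) a b \<ge> 0"
    unfolding split_vol_def using assms by (intro sum_nonneg) auto
  then show "measure lebesgue ?E = split_vol CARD('n) a b"
    using sets em by (simp add: measure_def)
qed

subsection \<open>Linear images and the node matrix\<close>

text \<open>The library's \<open>measure_linear_image\<close> requires a well-ordered index type,
  which \<open>'n\<close> need not be.\<close>

proposition measurable_linear_image_cart:
  fixes f :: "real^'n \<Rightarrow> real^'n"
  assumes "linear f" "S \<in> lmeasurable"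
  shows "f ` S \<in> lmeasurable \<and> measure lebesgue (f ` S) = \<bar>det (matrix f)\<bar> * measure lebesgue S"
proof -
  define P where "P f \<longleftrightarrow> (\<forall>S \<in> lmeasurable. f ` S \<in> lmeasurable \<and>
      measure lebesgue (f ` S) = \<bar>det (matrix f)\<bar> * measure lebesgue S)" for f :: "real^'n \<Rightarrow> real^'n"
  \<comment> \<open>For a map of determinant 1 or -1 it suffices to check that the measure of boxes
    is preserved.\<close>
  have P_boxI: "P h" if "linear h" "\<bar>det (matrix h)\<bar> = 1"
    and "\<And>a b. cbox a b \<noteq> {} \<Longrightarrow> measure lebesgue (h ` cbox a b) = measure lebesgue (cbox a b)" for h
    unfolding P_def
  proof
    fix S :: "(real^'n) set" assume "S \<in> lmeasurable"
    moreover have "measure lebesgue (h ` cbox a b) = 1 * measure lebesgue (cbox a b)" for a b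
      using that(3) [of a b] by (cases "cbox a b = {}") auto
    ultimately show "h ` S \<in> lmeasurable \<and> measure lebesgue (h ` S) = \<bar>det (matrix h)\<bar> * measure lebesgue S"
      using measure_linear_sufficient [OF that(1), of S 1] that(2) by simp
  qed
  have "P f"
    using \<open>linear f\<close>
  proof (rule induct_linear_elementary)
    fix f g :: "real^'n \<Rightarrow> real^'n"
    assume fg: "linear f" "linear g" and P: "P f" "P g"
    have "det (matrix (f \<circ> g)) = det (matrix f) * det (matrix g)"
      by (simp add: matrix_compose [OF fg(2,1)] det_mul)
    then show "P (f \<circ> g)"
      using P unfolding P_def image_comp [symmetric] by (simp only: abs_mult mult.assoc) metis
  next
    fix f :: "real^'n \<Rightarrow> real^'n" and i
    assume f: "linear f" and 0: "\<And>x. f x $ i = 0"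
    \<comment> \<open>A map with a coordinate that is always 0 is singular: its images are
      negligible and its determinant is 0.\<close>
    have "\<not> surj f"
      using 0 by (metis axis_nth one_neq_zero surjD)
    then have "\<not> inj f"
      using linear_injective_imp_surjective [OF f] by blast
    moreover from this have "negligible (f ` S)" for S
      by (rule negligible_linear_singular_image [OF f])
    ultimately show "P f"
      using det_nz_iff_inj [OF f] by (auto simp: P_def negligible_iff_measure)
  next
    fix c
    show "P (\<lambda>x. \<chi> i. c i * x $ i)"
      by (simp add: P_def measurable_stretch measure_stretch matrix_def axis_def det_diagonal)
  next
    fix m n :: 'n assume "m \<noteq> n"
    let ?h = "\<lambda>x::real^'n. \<chi> i. x $ Transposition.transpose m n i"
    show "P ?h"
    proof (rule P_boxI)
      show "linear ?h"
        by (rule linearI) (simp_all add: vec_eq_iff)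
      have "matrix ?h = (\<chi> i. mat 1 $ Transposition.transpose m n i)"
        by (simp add: matrix_def axis_def mat_def vec_eq_iff)
      then show "\<bar>det (matrix ?h)\<bar> = 1"
        by (simp add: det_permute_rows permutes_swap_id sign_swap_id)
    next
      fix a b :: "real^'n" assume ab: "cbox a b \<noteq> {}"
      have h2: "?h (?h x) = x" for x
        by (simp add: vec_eq_iff)
      have sub: "?h ` cbox u v \<subseteq> cbox (?h u) (?h v)" for u v
        by (auto simp: mem_box_cart)
      have eq: "?h ` cbox a b = cbox (?h a) (?h b)"
      proof
        \<comment> \<open>\<open>?h\<close> is an involution, so applying it to an instance of
          \<open>sub\<close> gives the reverse inclusion.\<close>
        show "cbox (?h a) (?h b) \<subseteq> ?h ` cbox a b"
          using image_mono [OF sub [of "?h a" "?h b"], of ?h] unfolding h2 image_image by simp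
      qed (rule sub)
      have "(\<Prod>i\<in>UNIV. (b - a) $ i) = (\<Prod>i\<in>UNIV. (b - a) $ Transposition.transpose m n i)"
        using prod.permute [OF permutes_swap_id, of m UNIV n "\<lambda>i. (b - a) $ i"] by (simp add: o_def)
      moreover have "cbox (?h a) (?h b) \<noteq> {}"
        using ab eq by blast
      ultimately show "measure lebesgue (?h ` cbox a b) = measure lebesgue (cbox a b)"
        using ab by (simp add: eq content_cbox_cart)
    qed
  next
    fix m n :: 'n assume "m \<noteq> n"
    let ?h = "\<lambda>x::real^'n. \<chi> i. if i = m then x $ m + x $ n else x $ i"
    show "P ?h"
    proof (rule P_boxI)
      show "linear ?h"
        by (rule linearI) (simp_all add: vec_eq_iff algebra_simps)
      have "matrix ?h = (\<chi> i. if i = m then row m (mat 1) + row n (mat 1) else row i (mat 1))"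
        by (auto simp: matrix_def axis_def mat_def row_def vec_eq_iff)
      moreover have "det \<dots> = det (mat 1 :: real^'n^'n)"
        using \<open>m \<noteq> n\<close> by (intro det_row_span vec.span_base) auto
      ultimately show "\<bar>det (matrix ?h)\<bar> = 1"
        by simp
    next
      fix a b :: "real^'n" assume ab: "cbox a b \<noteq> {}"
      \<comment> \<open>Translating the lower corner to the origin brings the box into a position
        where \<open>measure_shear_interval\<close> applies.\<close>
      have box: "cbox a b = (+) a ` cbox 0 (b - a)"
        using cbox_translation [of a 0 "b - a"] by simp
      have "?h ` cbox a b = (+) (?h a) ` ?h ` cbox 0 (b - a)"
        unfolding box image_image by (intro image_cong) (auto simp: vec_eq_iff)
      then have "measure lebesgue (?h ` cbox a b) = measure lebesgue (?h ` cbox 0 (b - a))"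
        by (simp only: measure_translation)
      also have "\<dots> = measure lebesgue (cbox 0 (b - a))"
        using ab \<open>m \<noteq> n\<close> box by (intro measure_shear_interval) auto
      finally show "measure lebesgue (?h ` cbox a b) = measure lebesgue (cbox a b)"
        by (simp only: box measure_translation)
    qed
  qed
  then show ?thesis
    using assms by (simp add: P_def)
qed

section \<open>Determinants of the node matrix and of the edge vectors\<close>

lemma sum_option:
  fixes f :: "'n::finite option \<Rightarrow> 'a::comm_monoid_add"
  shows "(\<Sum>k\<in>UNIV. f k) = f None + (\<Sum>i\<in>UNIV. f (Some i))"
  by (simp add: UNIV_option_conv sum.reindex)

text \<open>In the Leibniz expansion, a permutation that moves \<open>None\<close> picks a zero
  entry from column \<open>None\<close>. The others are the permutations of the \<open>Some\<close>
  indices, with the same sign.\<close>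

lemma det_border:
  fixes A :: "real^('n::finite option)^('n option)"
  assumes 0: "\<And>i. A $ Some i $ None = 0" and 1: "A $ None $ None = 1"
  shows "det A = det (\<chi> i j. A $ Some i $ Some j)"
proof -
  let ?T = "\<lambda>p. of_int (sign p) * (\<Prod>i\<in>UNIV. A $ i $ p i)"
  let ?R = "range (Some :: 'n \<Rightarrow> 'n option)"
  let ?m = "map_permutation UNIV (Some :: 'n \<Rightarrow> 'n option)"
  have bij: "bij_betw Some UNIV ?R"
    by (simp add: bij_betw_def)
  have m_Some: "?m p (Some i) = Some (p i)" for p i
    by (rule map_permutation_apply) auto
  have m_perm: "?m p permutes ?R" if "p permutes UNIV" for p
    by (rule map_permutation_permutes [OF bij that])
  have "det A = (\<Sum>p | p permutes ?R. ?T p)"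
    unfolding det_def
  proof (rule sum.mono_neutral_right)
    show "\<forall>p\<in>{p. p permutes UNIV} - {p. p permutes ?R}. ?T p = 0"
    proof
      fix p :: "'n option \<Rightarrow> 'n option" assume p: "p \<in> {p. p permutes UNIV} - {p. p permutes ?R}"
      then have "surj p"
        by (intro permutes_surj) auto
      then obtain k where k: "p k = None"
        by (metis surjD)
      have "k \<noteq> None"
      proof
        assume "k = None"
        then have "p permutes ?R"
          using p k by (intro permutes_superset [of p UNIV ?R]) (auto simp: notin_range_Some)
        then show False using p by blast
      qed
      then have "A $ k $ p k = 0"
        using k 0 by (cases k) auto
      then have "(\<Prod>i\<in>UNIV. A $ i $ p i) = 0"
        by (intro prod_zero) auto
      then show "?T p = 0" by simp
    qed
  qed (auto intro: permutes_subset finite_permutations)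
  also have "\<dots> = (\<Sum>p | p permutes UNIV. ?T (?m p))"
  proof (rule sum.reindex_bij_witness [of _ ?m "map_permutation ?R the"])
    fix q assume "q \<in> {q. q permutes ?R}"
    then have q: "q permutes ?R" by simp
    have bij': "bij_betw the ?R UNIV"
      by (rule bij_betw_byWitness [of _ Some]) auto
    show "map_permutation ?R the q \<in> {p. p permutes UNIV}"
      using map_permutation_permutes [OF bij' q] by simp
    show "?m (map_permutation ?R the q) = q"
      by (rule map_permutation_compose_inv [OF bij' q]) auto
    then show "?T (?m (map_permutation ?R the q)) = ?T q" by simp
  next
    fix p assume "p \<in> {p::'n \<Rightarrow> 'n. p permutes UNIV}"
    then have p: "p permutes UNIV" by simp
    show "map_permutation ?R the (?m p) = p"
      by (rule map_permutation_compose_inv [OF bij p]) auto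
    show "?m p \<in> {q. q permutes ?R}"
      using m_perm [OF p] by simp
  qed
  also have "\<dots> = det (\<chi> i j. A $ Some i $ Some j)"
    unfolding det_def
  proof (rule sum.cong)
    fix p assume "p \<in> {p::'n \<Rightarrow> 'n. p permutes UNIV}"
    then have p: "p permutes UNIV" by simp
    have "?m p None = None"
      using permutes_not_in [OF m_perm [OF p]] by blast
    then have "(\<Prod>i\<in>UNIV. A $ i $ ?m p i) = (\<Prod>i\<in>UNIV. A $ Some i $ Some (p i))"
      using 1 by (simp add: UNIV_option_conv prod.reindex m_Some)
    then show "?T (?m p) = of_int (sign p) * (\<Prod>i\<in>UNIV. (\<chi> i j. A $ Some i $ Some j) $ i $ p i)"
      using sign_map_permutation [of Some UNIV p] p by simp
  qed simp
  finally show ?thesis .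
qed

text \<open>The linear part of the affine map taking x to the point with barycentric coordinates
  \<open>x $ i\<close> at \<open>V (Some i)\<close>, the remaining weight going to
  \<open>V None\<close>.\<close>

definition edge_matrix :: "('n option \<Rightarrow> real^'n) \<Rightarrow> real^'n^'n" where
  "edge_matrix V = (\<chi> i j. (V (Some j) - V None) $ i)"

lemma edge_matrix_mult:
  fixes V :: "'n::finite option \<Rightarrow> real^'n"
  shows "edge_matrix V *v x = (\<Sum>i\<in>UNIV. x $ i *\<^sub>R (V (Some i) - V None))"
  by (simp add: vec_eq_iff edge_matrix_def matrix_vector_mult_def mult.commute)

text \<open>Row operations turn column \<open>None\<close> of the node matrix into a unit vector;
  the block that remains is the transposed edge matrix.\<close>

lemma det_edge_matrix:
  fixes V :: "'n::finite option \<Rightarrow> real^'n"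
  shows "det (edge_matrix V) = det (node_matrix V)"
proof -
  \<comment> \<open>\<open>L\<close> subtracts row \<open>None\<close> from all other rows.\<close>
  define L :: "real^('n option)^('n option)" where
    "L = (\<chi> j k. if j = k then 1 else if k = None then - 1 else 0)"
  let ?B = "L ** node_matrix V"
  \<comment> \<open>\<open>L\<close> has its zeros in row \<open>None\<close>, whereas
    \<open>det_border\<close> asks for them in column \<open>None\<close>; hence the
    transpose.\<close>
  have "det (transpose L) = det (\<chi> i j. transpose L $ Some i $ Some j)"
    by (rule det_border) (auto simp: L_def transpose_def)
  also have "(\<chi> i j. transpose L $ Some i $ Some j) = mat 1"
    by (auto simp: L_def transpose_def mat_def vec_eq_iff)
  finally have "det ?B = det (node_matrix V)"
    by (simp add: det_mul)
  moreover have B: "?B $ None $ k = node_matrix V $ None $ k"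
    "?B $ Some i $ k = node_matrix V $ Some i $ k - node_matrix V $ None $ k" for i k
    by (simp_all add: L_def matrix_matrix_mult_def sum_option mult_delta_left cong: if_cong)
  then have "det ?B = det (\<chi> i j. ?B $ Some i $ Some j)"
    by (intro det_border; simp only: B) (simp_all add: node_matrix_def)
  moreover have "(\<chi> i j. ?B $ Some i $ Some j) = transpose (edge_matrix V)"
    by (simp add: B transpose_def edge_matrix_def vec_eq_iff) (simp add: node_matrix_def)
  ultimately show ?thesis by simp
qed

subsection \<open>Barycentric coordinates and interpolation\<close>

text \<open>The barycentric coordinates as the solution u of u A = (x, 1), for an invertible node
  matrix A: column \<open>None\<close> says that the weights sum to 1, the others that they combine
  the vertices to x.\<close>

definition bary :: "('n::finite option \<Rightarrow> real^'n) \<Rightarrow> real^'n \<Rightarrow> real^('n option)" where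
  "bary V x = (\<chi> k. case k of Some i \<Rightarrow> x $ i | None \<Rightarrow> 1) v* matrix_inv (node_matrix V)"

lemma bary_affine: "\<exists>a b. \<forall>x. bary V x $ j = a \<bullet> x + b"
proof (intro exI allI)
  fix x
  show "bary V x $ j = (\<chi> i. matrix_inv (node_matrix V) $ Some i $ j) \<bullet> x + matrix_inv (node_matrix V) $ None $ j"
    by (simp add: bary_def vector_matrix_mult_def sum_option inner_vec_def mult.commute)
qed

context
  fixes V :: "'n::finite option \<Rightarrow> real^'n"
  assumes det: "det (node_matrix V) \<noteq> 0"
begin

lemma inverse_node_matrix:
  "node_matrix V ** matrix_inv (node_matrix V) = mat 1"
  "matrix_inv (node_matrix V) ** node_matrix V = mat 1"
  using det someI_ex [of "\<lambda>B. node_matrix V ** B = mat 1 \<and> B ** node_matrix V = mat 1"]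
  by (auto simp: invertible_det_nz [symmetric] invertible_def matrix_inv_def)

lemma bary_mult: "bary V x v* node_matrix V = (\<chi> k. case k of Some i \<Rightarrow> x $ i | None \<Rightarrow> 1)"
  unfolding bary_def vector_matrix_mul_assoc inverse_node_matrix by simp

lemma sum_bary: "(\<Sum>j\<in>UNIV. bary V x $ j) = 1"
  using arg_cong [OF bary_mult, of "\<lambda>v. v $ None"]
  by (simp add: vector_matrix_mult_def node_matrix_def mult.commute)

lemma bary_combination: "(\<Sum>j\<in>UNIV. bary V x $ j *\<^sub>R V j) = x"
  unfolding vec_eq_iff
proof
  fix i
  show "(\<Sum>j\<in>UNIV. bary V x $ j *\<^sub>R V j) $ i = x $ i"
    using arg_cong [OF bary_mult, of "\<lambda>v. v $ Some i"]
    by (simp add: vector_matrix_mult_def node_matrix_def mult.commute)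
qed

text \<open>The vector (V i, 1) is row i of the node matrix, so multiplying by the inverse gives row
  i of the identity.\<close>

lemma bary_vertex: "bary V (V i) $ j = (if i = j then 1 else 0)"
proof -
  have "bary V (V i) = node_matrix V $ i v* matrix_inv (node_matrix V)"
    unfolding bary_def by (rule arg_cong [of _ _ "\<lambda>v. v v* _"]) (auto simp: node_matrix_def vec_eq_iff split: option.split)
  also have "\<dots> = (node_matrix V ** matrix_inv (node_matrix V)) $ i"
    by (simp add: vec_eq_iff matrix_matrix_mult_def vector_matrix_mult_def mult.commute)
  finally show ?thesis
    by (simp add: inverse_node_matrix mat_def)
qed

lemma inj_vertices: "inj V"
proof (rule injI)
  fix i j assume "V i = V j"
  then have "bary V (V i) $ j = bary V (V j) $ j" by simp
  then show "i = j" by (simp add: bary_vertex split: if_splits)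
qed

text \<open>The barycentric coordinates are the Lagrange basis at the vertices. Uniqueness holds
  since an affine function commutes with combinations whose weights sum to 1.\<close>

lemma interp_eq: "interp V f = (\<lambda>x. \<Sum>j\<in>UNIV. f (V j) * bary V x $ j)"
  unfolding interp_def
proof (rule the_equality, intro conjI allI)
  obtain a b where ab: "\<And>j x. bary V x $ j = a j \<bullet> x + b j"
    using bary_affine [of V] by metis
  have "(\<Sum>j\<in>UNIV. f (V j) * bary V x $ j) = (\<Sum>j\<in>UNIV. f (V j) *\<^sub>R a j) \<bullet> x + (\<Sum>j\<in>UNIV. f (V j) * b j)" for x
    by (simp add: ab inner_sum_left sum.distrib distrib_left)
  then show "(\<lambda>x. \<Sum>j\<in>UNIV. f (V j) * bary V x $ j) \<in> Pi1"
    unfolding Pi1_def by blast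
  show "(\<Sum>j\<in>UNIV. f (V j) * bary V (V i) $ j) = f (V i)" for i
    by (simp add: bary_vertex mult_delta_right)
next
  fix p assume p: "p \<in> Pi1 \<and> (\<forall>j. p (V j) = f (V j))"
  then obtain a b where ab: "\<And>x. p x = a \<bullet> x + b"
    by (auto simp: Pi1_def)
  show "p = (\<lambda>x. \<Sum>j\<in>UNIV. f (V j) * bary V x $ j)"
  proof
    fix x
    have "p x = a \<bullet> (\<Sum>j\<in>UNIV. bary V x $ j *\<^sub>R V j) + b * (\<Sum>j\<in>UNIV. bary V x $ j)"
      by (simp add: ab bary_combination sum_bary)
    also have "\<dots> = (\<Sum>j\<in>UNIV. p (V j) * bary V x $ j)"
      by (simp add: ab inner_sum_right sum_distrib_left sum.distrib algebra_simps)
    finally show "p x = (\<Sum>j\<in>UNIV. f (V j) * bary V x $ j)"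
      using p by simp
  qed
qed

text \<open>Makes both suprema in \<open>interp_norm\<close> range over bounded sets, so that they
  are upper bounds of their members.\<close>

lemma bary_bounded: "\<exists>C. \<forall>x\<in>unit_ball. (\<Sum>j\<in>UNIV. \<bar>bary V x $ j\<bar>) \<le> C"
proof -
  obtain a b where ab: "\<And>j x. bary V x $ j = a j \<bullet> x + b j"
    using bary_affine [of V] by metis
  have "\<bar>a j \<bullet> x + b j\<bar> \<le> norm (a j) + \<bar>b j\<bar>" if "x \<in> unit_ball" for x j
  proof -
    have "\<bar>a j \<bullet> x\<bar> \<le> norm (a j) * norm x"
      by (rule Cauchy_Schwarz_ineq2)
    also have "\<dots> \<le> norm (a j)"
      using that by (simp add: unit_ball_def mult_left_le)
    finally show ?thesis by simp
  qed
  then show ?thesis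
    by (auto simp: ab intro!: exI [of _ "\<Sum>j\<in>UNIV. norm (a j) + \<bar>b j\<bar>"] sum_mono)
qed

lemma sum_abs_bary_le_interp_norm:
  assumes V: "\<And>j. V j \<in> unit_ball" and x: "x \<in> unit_ball"
  shows "(\<Sum>j\<in>UNIV. \<bar>bary V x $ j\<bar>) \<le> interp_norm V"
proof -
  let ?F = "{f. continuous_on unit_ball f \<and> (\<forall>x\<in>unit_ball. \<bar>f x\<bar> \<le> 1)} :: (real^'n \<Rightarrow> real) set"
  obtain C where C: "\<And>x. x \<in> unit_ball \<Longrightarrow> (\<Sum>j\<in>UNIV. \<bar>bary V x $ j\<bar>) \<le> C"
    using bary_bounded by blast
  have bound: "\<bar>interp V f y\<bar> \<le> C" if "f \<in> ?F" "y \<in> unit_ball" for f y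
  proof -
    have "\<bar>interp V f y\<bar> \<le> (\<Sum>j\<in>UNIV. \<bar>f (V j) * bary V y $ j\<bar>)"
      unfolding interp_eq by (rule sum_abs)
    also have "\<dots> \<le> (\<Sum>j\<in>UNIV. \<bar>bary V y $ j\<bar>)"
      using that V by (intro sum_mono) (auto simp: abs_mult intro: mult_left_le_one_le)
    finally show ?thesis using C [OF that(2)] by simp
  qed
  have ball_ne: "unit_ball \<noteq> ({} :: (real^'n) set)"
    using V by blast
  \<comment> \<open>The signs are prescribed on the vertices only, which is consistent because
    \<open>V\<close> is injective; Tietze's theorem extends them to the ball with the same bound
    1.\<close>
  define s where "s v = sgn (bary V x $ (inv V v))" for v
  have "finite (range V)" by simp
  moreover have "range V \<subseteq> unit_ball" using V by blast
  ultimately have "closedin (top_of_set unit_ball) (range V)"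
    by (intro closed_subset finite_imp_closed)
  moreover have "continuous_on (range V) s"
    by (intro continuous_on_finite) simp
  moreover have "norm (s v) \<le> 1" for v
    by (simp add: s_def abs_sgn_eq)
  ultimately obtain f where f: "continuous_on unit_ball f" "\<And>v. v \<in> range V \<Longrightarrow> f v = s v"
    "\<And>v. v \<in> unit_ball \<Longrightarrow> norm (f v) \<le> 1"
    using Tietze [of "range V" s unit_ball 1] by auto
  then have fF: "f \<in> ?F" by simp
  have "(\<Sum>j\<in>UNIV. \<bar>bary V x $ j\<bar>) = interp V f x"
    unfolding interp_eq using f(2) inj_vertices
    by (intro sum.cong) (auto simp: s_def abs_sgn)
  also have "\<dots> \<le> \<bar>interp V f x\<bar>"
    by simp
  also have "\<dots> \<le> (SUP y\<in>unit_ball. \<bar>interp V f y\<bar>)"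
    using bound [OF fF] x by (intro cSUP_upper bdd_aboveI2 [of _ _ C]) auto
  also have "\<dots> \<le> interp_norm V"
    unfolding interp_norm_def
  proof (rule cSUP_upper [OF fF], rule bdd_aboveI2)
    show "(SUP y\<in>unit_ball. \<bar>interp V g y\<bar>) \<le> C" if "g \<in> ?F" for g
      using bound [OF that] by (intro cSUP_least ball_ne) auto
  qed
  finally show ?thesis .
qed

end

subsection \<open>Volume comparison\<close>

text \<open>The factor n! between \<open>legendre\<close> and \<open>split_vol\<close> cancels the
  one in the denominator of \<open>simplex_vol\<close>.\<close>

lemma measure_edge_image:
  fixes V :: "'n::finite option \<Rightarrow> real^'n"
  assumes "t \<ge> 1"
  defines "E \<equiv> (+) (V None) ` (*v) (edge_matrix V) ` split_simplex ((t + 1) / 2) ((t - 1) / 2)"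
  shows "E \<in> lmeasurable" and "measure lebesgue E = simplex_vol V * legendre CARD('n) t"
proof -
  let ?S = "split_simplex ((t + 1) / 2) ((t - 1) / 2) :: (real^'n) set"
  have S: "?S \<in> lmeasurable" "measure lebesgue ?S = split_vol CARD('n) ((t + 1) / 2) ((t - 1) / 2)"
    using assms by (auto intro: split_simplex_lmeasurable)
  note image = measurable_linear_image_cart [OF matrix_vector_mul_linear S(1), of "edge_matrix V"]
  show "E \<in> lmeasurable"
    unfolding E_def using image by (auto intro: measurable_translation)
  have "measure lebesgue E = \<bar>det (edge_matrix V)\<bar> * measure lebesgue ?S"
    unfolding E_def measure_translation using image by simp
  then show "measure lebesgue E = simplex_vol V * legendre CARD('n) t"
    by (simp add: S det_edge_matrix simplex_vol_def legendre_eq_split_vol)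
qed

lemma lmeasurable_unit_ball: "(unit_ball :: (real^'n) set) \<in> lmeasurable"
  by (simp add: unit_ball_def)

lemma measure_unit_ball: "measure lebesgue (unit_ball :: (real^'n) set) = kappa TYPE('n)"
  by (simp add: unit_ball_def kappa_def)

lemma simplex_vol_le_kappa:
  fixes V :: "'n::finite option \<Rightarrow> real^'n"
  assumes V: "\<And>j. V j \<in> unit_ball"
  shows "simplex_vol V \<le> kappa TYPE('n)"
proof -
  \<comment> \<open>The parameters 1 and 0 are left unevaluated to match
    \<open>measure_edge_image\<close> at t = 1.\<close>
  let ?E = "(+) (V None) ` (*v) (edge_matrix V) ` split_simplex ((1 + 1) / 2) ((1 - 1) / 2)"
  have "?E \<subseteq> unit_ball"
  proof clarify
    fix x :: "real^'n" assume "x \<in> split_simplex ((1 + 1) / 2) ((1 - 1) / 2)"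
    then have pos: "(\<Sum>i\<in>UNIV. max (x $ i) 0) \<le> 1" and neg: "(\<Sum>i\<in>UNIV. max (- (x $ i)) 0) \<le> 0"
      by (auto simp: split_simplex_def)
    have "\<forall>i\<in>UNIV. max (- (x $ i)) 0 = 0"
      using neg by (subst sum_nonneg_eq_0_iff [symmetric]) (auto intro!: antisym sum_nonneg)
    then have x0: "x $ i \<ge> 0" for i
      by (metis UNIV_I max.cobounded1 neg_le_0_iff_le)
    define u where "u j = (case j of Some i \<Rightarrow> x $ i | None \<Rightarrow> 1 - (\<Sum>i\<in>UNIV. x $ i))" for j
    have "(\<Sum>j\<in>UNIV. u j *\<^sub>R V j) \<in> unit_ball"
    proof (rule convex_sum)
      show "convex (unit_ball :: (real^'n) set)"
        by (simp add: unit_ball_def)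
      show "sum u UNIV = 1"
        by (simp add: sum_option u_def)
      show "u j \<ge> 0" for j
        using pos x0 by (cases j) (auto simp: u_def max_absorb1)
    qed (auto intro: V)
    also have "(\<Sum>j\<in>UNIV. u j *\<^sub>R V j) = V None + edge_matrix V *v x"
      by (simp add: sum_option u_def edge_matrix_mult algebra_simps sum.distrib sum_subtractf
          scaleR_sum_left [symmetric])
    finally show "V None + edge_matrix V *v x \<in> unit_ball" .
  qed
  then have "measure lebesgue ?E \<le> kappa TYPE('n)"
    unfolding measure_unit_ball [symmetric]
    by (intro measure_mono_fmeasurable lmeasurable_unit_ball fmeasurableD measure_edge_image) auto
  moreover have "measure lebesgue ?E = simplex_vol V * legendre CARD('n) 1"
    by (rule measure_edge_image) simp
  moreover have "legendre CARD('n) 1 = 1"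
    by (simp add: legendre_eq_split_vol split_vol_0_right)
  ultimately show ?thesis by simp
qed

lemma kappa_le_simplex_vol_legendre:
  fixes V :: "'n::finite option \<Rightarrow> real^'n"
  assumes det: "det (node_matrix V) \<noteq> 0" and "t \<ge> 1"
    and t: "\<And>x. x \<in> unit_ball \<Longrightarrow> (\<Sum>j\<in>UNIV. \<bar>bary V x $ j\<bar>) \<le> t"
  shows "kappa TYPE('n) \<le> simplex_vol V * legendre CARD('n) t"
proof -
  let ?E = "(+) (V None) ` (*v) (edge_matrix V) ` split_simplex ((t + 1) / 2) ((t - 1) / 2)"
  have "unit_ball \<subseteq> ?E"
  proof
    fix x :: "real^'n" assume x: "x \<in> unit_ball"
    let ?u = "\<lambda>j. bary V x $ j"
    \<comment> \<open>Adding the nonnegative term for \<open>None\<close> gives a sum over all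
      vertices, where max u 0 = (|u| + u) / 2 and the weights sum to 1.\<close>
    have pos: "(\<Sum>i\<in>UNIV. max (?u (Some i)) 0) \<le> (t + 1) / 2"
    proof -
      have "(\<Sum>i\<in>UNIV. max (?u (Some i)) 0) \<le> (\<Sum>j\<in>UNIV. max (?u j) 0)"
        by (simp add: sum_option)
      also have "\<dots> = (\<Sum>j\<in>UNIV. (\<bar>?u j\<bar> + ?u j) / 2)"
        by (intro sum.cong) auto
      also have "\<dots> = ((\<Sum>j\<in>UNIV. \<bar>?u j\<bar>) + 1) / 2"
        by (simp add: sum_divide_distrib [symmetric] sum.distrib sum_bary [OF det])
      finally show ?thesis using t [OF x] by simp
    qed
    have neg: "(\<Sum>i\<in>UNIV. max (- ?u (Some i)) 0) \<le> (t - 1) / 2"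
    proof -
      have "(\<Sum>i\<in>UNIV. max (- ?u (Some i)) 0) \<le> (\<Sum>j\<in>UNIV. max (- ?u j) 0)"
        by (simp add: sum_option)
      also have "\<dots> = (\<Sum>j\<in>UNIV. (\<bar>?u j\<bar> - ?u j) / 2)"
        by (intro sum.cong) auto
      also have "\<dots> = ((\<Sum>j\<in>UNIV. \<bar>?u j\<bar>) - 1) / 2"
        by (simp add: sum_divide_distrib [symmetric] sum_subtractf sum_bary [OF det])
      finally show ?thesis using t [OF x] by simp
    qed
    \<comment> \<open>The added term is zero; it serves to rewrite the combination with
      \<open>V None\<close> as base point.\<close>
    have "x = (\<Sum>j\<in>UNIV. ?u j *\<^sub>R V j) + (1 - (\<Sum>j\<in>UNIV. ?u j)) *\<^sub>R V None"
      by (simp add: bary_combination [OF det] sum_bary [OF det])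
    also have "\<dots> = V None + edge_matrix V *v (\<chi> i. ?u (Some i))"
      by (simp add: sum_option edge_matrix_mult algebra_simps sum_subtractf scaleR_sum_left [symmetric])
    finally show "x \<in> ?E"
      using pos neg by (auto simp: split_simplex_def image_image)
  qed
  then have "kappa TYPE('n) \<le> measure lebesgue ?E"
    unfolding measure_unit_ball [symmetric]
    using \<open>t \<ge> 1\<close> by (intro measure_mono_fmeasurable fmeasurableD [OF lmeasurable_unit_ball] measure_edge_image)
  then show ?thesis
    using measure_edge_image(2) [OF \<open>t \<ge> 1\<close>, of V] by simp
qed

theorem theorem1:
  fixes V :: "'n::finite option \<Rightarrow> real^'n"
  assumes "\<And>j. V j \<in> unit_ball"
    and "det (node_matrix V) \<noteq> 0"
  shows "interp_norm V \<ge> legendre_inv CARD('n) (kappa TYPE('n) / simplex_vol V)"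
proof (rule legendre_inv_le)
  have vol: "simplex_vol V > 0"
    using assms(2) by (simp add: simplex_vol_def)
  have t: "(\<Sum>j\<in>UNIV. \<bar>bary V x $ j\<bar>) \<le> interp_norm V" if "x \<in> unit_ball" for x
    using assms that by (intro sum_abs_bary_le_interp_norm)
  \<comment> \<open>At any point of the ball the weights sum to 1, so their absolute values sum to
    at least 1; a vertex is such a point.\<close>
  have "1 = \<bar>\<Sum>j\<in>UNIV. bary V (V None) $ j\<bar>"
    by (simp add: sum_bary [OF assms(2)])
  also have "\<dots> \<le> interp_norm V"
    using sum_abs t [OF assms(1)] by (rule order_trans)
  finally show t1: "1 \<le> interp_norm V" .
  show "1 \<le> kappa TYPE('n) / simplex_vol V"
    using simplex_vol_le_kappa [of V] assms(1) vol by simp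
  show "kappa TYPE('n) / simplex_vol V \<le> legendre CARD('n) (interp_norm V)"
    using kappa_le_simplex_vol_legendre [OF assms(2) t1 t] vol by (simp add: field_simps)
qed simp

end
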